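(* Let $(X,d)$ be a complete metric space and let $f\colon X\to[-\infty,+\infty]$ be a lower semicontinuous function that is bounded below. Then for any point $x\in X$ with $f(x)<+\infty$ and any constants $\alpha,\beta>0$ satisfying $\alpha\beta<\frac12$, there exists a point $x_+\in X$ satisfying $$f(x)-f(x_+)\ \ge\ \alpha\, d^2(x,x_+)\qquad\text{and}\qquad d(x,x_+)\ \ge\ \beta\,|\overline{\nabla} f|(x_+).$$
   Context: Slope: for a metric space $(X,d)$, a function $f\colon X\to[-\infty,+\infty]$ and a point $x$ with $f(x)$ finite, $|\nabla f|(x)$ is the infimum of those $\epsilon>0$ for which $x$ is a local minimizer of $y\mapsto f(y)+\epsilon\, d(x,y)$ (with $\inf\emptyset=+\infty$); if $f(x)=+\infty$ then $|\nabla f|(x)=+\infty$. Limiting slope: for $\bar x$ with $f(\bar x)$ finite, $|\overline{\nabla} f|(\bar x)=\liminf_{x\to\bar x,\ f(x)\to f(\bar x)}|\nabla f|(x)$ (points $x=\bar x$ allowed), i.e. $\lim_{r\downarrow0}\inf\{|\nabla f|(x): d(x,\bar x)<r,\ |f(x)-f(\bar x)|<r\}$. *)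

theory Defs
  imports "HOL-Analysis.Analysis"
begin

definition lsc :: "('a::topological_space \<Rightarrow> ereal) \<Rightarrow> bool" where
  "lsc f \<longleftrightarrow> (\<forall>x. f x \<le> Liminf (at x) f)"

definition local_minimizer :: "('a::topological_space \<Rightarrow> ereal) \<Rightarrow> 'a \<Rightarrow> bool" where
  "local_minimizer g x \<longleftrightarrow> (\<forall>\<^sub>F y in nhds x. g x \<le> g y)"

(* Meaningful when f x is not -\<infinity>; the infimum over the empty set is \<infinity>. *)
definition slope :: "('a::metric_space \<Rightarrow> ereal) \<Rightarrow> 'a \<Rightarrow> ereal" where
  "slope f x =
     (if f x = \<infinity> then \<infinity>
      else Inf {ereal e | e :: real. 0 < e \<and> local_minimizer (\<lambda>y. f y + ereal (e * dist x y)) x})"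

(* The filter describes the convergence of y to x together with f y to f x, the point y = x
   being allowed. Meaningful when f x is finite. *)
definition limiting_slope :: "('a::metric_space \<Rightarrow> ereal) \<Rightarrow> 'a \<Rightarrow> ereal" where
  "limiting_slope f x = Liminf (inf (nhds x) (filtercomap f (nhds (f x)))) (slope f)"

lemma limiting_slope_eq:
  assumes fin: "\<bar>f x\<bar> \<noteq> \<infinity>"
  shows "limiting_slope f x =
    (SUP r\<in>{0<..}. INF y\<in>{y. dist y x < r \<and> \<bar>f y - f x\<bar> < ereal r}. slope f y)"
proof -
  let ?F = "inf (nhds x) (filtercomap f (nhds (f x)))"
  let ?A = "\<lambda>r. {y. dist y x < r \<and> \<bar>f y - f x\<bar> < ereal r}"
  have ev: "\<forall>\<^sub>F y in ?F. y \<in> ?A r" if "r > 0" for r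
  proof -
    have 1: "\<forall>\<^sub>F y in nhds x. dist y x < r"
      using that by (auto simp: eventually_nhds_metric)
    from fin obtain c where c: "f x = ereal c" by (cases "f x") auto
    have "\<forall>\<^sub>F z in nhds (f x). z \<in> {ereal (c - r)<..<ereal (c + r)}"
      using that c by (intro eventually_nhds_in_open) auto
    hence "\<forall>\<^sub>F z in nhds (f x). \<bar>z - f x\<bar> < ereal r"
    proof (rule eventually_mono)
      fix z assume "z \<in> {ereal (c - r)<..<ereal (c + r)}"
      thus "\<bar>z - f x\<bar> < ereal r" by (cases z) (auto simp: c)
    qed
    hence 2: "\<forall>\<^sub>F y in filtercomap f (nhds (f x)). \<bar>f y - f x\<bar> < ereal r"
      by (rule eventually_filtercomapI)
    show ?thesis unfolding eventually_inf using 1 2 by auto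
  qed
  have base: "\<exists>r>0. \<forall>y\<in>?A r. P y" if "eventually P ?F" for P
  proof -
    from that obtain Q R where Q: "eventually Q (nhds x)"
      and R: "eventually R (filtercomap f (nhds (f x)))" and P: "\<And>y. Q y \<Longrightarrow> R y \<Longrightarrow> P y"
      unfolding eventually_inf by auto
    from Q obtain d where d: "d > 0" "\<And>y. dist y x < d \<Longrightarrow> Q y"
      unfolding eventually_nhds_metric by auto
    from R obtain S where S: "eventually S (nhds (f x))" "\<And>y. S (f y) \<Longrightarrow> R y"
      unfolding eventually_filtercomap by auto
    from fin obtain c where c: "f x = ereal c" by (cases "f x") auto
    from S(1) obtain U where U: "open U" "ereal c \<in> U" "\<And>z. z \<in> U \<Longrightarrow> S z"
      unfolding eventually_nhds c by auto
    obtain e' where e': "e' > 0" "{ereal c - e'<..<ereal c + e'} \<subseteq> U"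
      by (rule ereal_open_cont_interval[OF U(1,2)]) auto
    define e where "e = (if e' = \<infinity> then 1 else real_of_ereal e')"
    have e: "e > 0" "{ereal c - ereal e<..<ereal c + ereal e} \<subseteq> U"
      using e' by (cases e'; force simp: e_def)+
    have "P y" if "y \<in> ?A (min d e)" for y
    proof (rule P)
      show "Q y" using that d by auto
      have "f y \<in> {ereal c - ereal e<..<ereal c + ereal e}"
        using that by (cases "f y") (auto simp: c)
      thus "R y" using e U S by auto
    qed
    thus ?thesis using d e by (intro exI[of _ "min d e"]) auto
  qed
  show ?thesis
    unfolding limiting_slope_def Liminf_def
  proof (rule antisym)
    show "(SUP P\<in>{P. eventually P ?F}. INF y\<in>{y. P y}. slope f y)
        \<le> (SUP r\<in>{0<..}. INF y\<in>?A r. slope f y)"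
    proof (rule SUP_mono)
      fix P assume "P \<in> {P. eventually P ?F}"
      then obtain r where "r > 0" "?A r \<subseteq> {y. P y}" using base[of P] by auto
      thus "\<exists>r\<in>{0<..}. (INF y\<in>{y. P y}. slope f y) \<le> (INF y\<in>?A r. slope f y)"
        by (intro bexI[of _ r] INF_superset_mono) auto
    qed
    show "(SUP r\<in>{0<..}. INF y\<in>?A r. slope f y)
        \<le> (SUP P\<in>{P. eventually P ?F}. INF y\<in>{y. P y}. slope f y)"
    proof (rule SUP_mono)
      fix r :: real assume "r \<in> {0<..}"
      with ev[of r] show "\<exists>P\<in>{P. eventually P ?F}.
          (INF y\<in>?A r. slope f y) \<le> (INF y\<in>{y. P y}. slope f y)"
        by (intro bexI[of _ "\<lambda>y. y \<in> ?A r"]) auto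
    qed
  qed
qed

end

theory Submission
  imports Defs
begin

text \<open>
  Apply Ekeland's variational principle to \<open>f + \<alpha> d\<^sup>2(x, \<cdot>)\<close> at \<open>x\<close> with a small constant \<open>\<delta>\<close>.
  It yields \<open>y\<close> with \<open>f y + \<alpha> d\<^sup>2(x, y) \<le> f x\<close> whose slope is at most \<open>2 \<alpha> d(x, y) + 2 \<delta>\<close>.
  If for some \<open>\<delta>\<close> this is at most \<open>d(x, y) / \<beta>\<close>, then \<open>y\<close> is the required point. Otherwise,
  since \<open>2 \<alpha> < 1 / \<beta>\<close>, both \<open>d(x, y)\<close> and the slope at \<open>y\<close> tend to \<open>0\<close> with \<open>\<delta>\<close>, and lower
  semicontinuity gives \<open>f y \<longlonglongrightarrow> f x\<close>; so the limiting slope vanishes at \<open>x\<close> and \<open>x\<close> itself works.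
\<close>

lemma lsc_iff_eventually:
  "lsc f \<longleftrightarrow> (\<forall>x c. c < f x \<longrightarrow> (\<forall>\<^sub>F y in nhds x. c < f y))"
  unfolding lsc_def le_Liminf_iff eventually_nhds_conv_at by auto

lemma lsc_add_continuous:
  fixes f :: "'a::t2_space \<Rightarrow> ereal"
  assumes f: "lsc f" and g: "\<And>x. isCont g x"
  shows "lsc (\<lambda>y. f y + ereal (g y))"
  unfolding lsc_iff_eventually
proof (intro allI impI)
  fix x c assume "c < f x + ereal (g x)"
  then obtain c' where c': "c < ereal c'" "ereal c' < f x + ereal (g x)"
    using ereal_dense2 by blast
  from c'(2) have "ereal (c' - g x) < f x" by (cases "f x") auto
  \<comment> \<open>A second real inserted leaves slack on both sides: \<open>f\<close> stays above
    \<open>d\<close> by semicontinuity, \<open>g\<close> above \<open>c' - d\<close> by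
    continuity.\<close>
  then obtain d where d: "ereal (c' - g x) < ereal d" "ereal d < f x"
    using ereal_dense2 by blast
  have "\<forall>\<^sub>F y in nhds x. ereal d < f y"
    using f d(2) unfolding lsc_iff_eventually by blast
  moreover have "\<forall>\<^sub>F y in nhds x. c' - d < g y"
    using g[of x] d(1) unfolding isCont_def tendsto_at_iff_tendsto_nhds
    by (intro order_tendstoD(1)[where y = "g x"]) auto
  ultimately show "\<forall>\<^sub>F y in nhds x. c < f y + ereal (g y)"
  proof eventually_elim
    case (elim y)
    then have "ereal c' < f y + ereal (g y)" by (cases "f y") auto
    with c'(1) show ?case by order
  qed
qed

text \<open>Near-minimizers are chosen successively in nested sets whose diameters shrink
  geometrically. Completeness gives a limit, and semicontinuity keeps it in all of these
  sets.\<close>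

lemma ekeland:
  fixes g :: "'a::complete_space \<Rightarrow> ereal"
  assumes lsc: "lsc g" and lb: "\<And>y. ereal m \<le> g y" and x: "g x < \<infinity>" and \<delta>: "\<delta> > 0"
  obtains y where "g y + ereal (\<delta> * dist x y) \<le> g x"
    and "\<And>z. g z + ereal (\<delta> * dist y z) \<le> g y \<Longrightarrow> z = y"
proof -
  \<comment> \<open>Ekeland's order: the conclusion asks for a point \<open>y\<close> of
    \<open>S x\<close> with \<open>S y\<close> reduced to \<open>y\<close>.\<close>
  define S where "S z = {w. g w + ereal (\<delta> * dist z w) \<le> g z}" for z
  have S_self: "z \<in> S z" for z by (simp add: S_def)
  have S_trans: "v \<in> S z" if "w \<in> S z" "v \<in> S w" for v w z
  proof -
    have "\<delta> * dist z v \<le> \<delta> * dist z w + \<delta> * dist w v"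
      using \<delta> dist_triangle[of z v w] by (simp flip: distrib_left)
    then show ?thesis
      using that lb[of v] lb[of w] lb[of z] unfolding S_def
      by (cases "g v"; cases "g w"; cases "g z") auto
  qed
  have S_fin: "g w < \<infinity>" if "w \<in> S z" "g z < \<infinity>" for w z
    using that unfolding S_def by (cases "g w") auto
  have step: "\<exists>w \<in> S z. \<forall>v \<in> S z. g w \<le> g v + ereal \<epsilon>" if z: "g z < \<infinity>" and "\<epsilon> > 0" for z \<epsilon>
  proof -
    let ?I = "INF w\<in>S z. g w"
    have "ereal m \<le> ?I" using lb by (simp add: INF_greatest)
    moreover have "?I \<le> g z" by (rule INF_lower[OF S_self])
    ultimately have "?I < ?I + ereal \<epsilon>"
      using z \<open>\<epsilon> > 0\<close> by (cases ?I) auto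
    then obtain w where w: "w \<in> S z" "g w < ?I + ereal \<epsilon>"
      by (subst (asm) INF_less_iff) auto
    have "g w \<le> g v + ereal \<epsilon>" if "v \<in> S z" for v
      using w(2) add_right_mono[OF INF_lower[OF that, of g], of "ereal \<epsilon>"] by order
    with w(1) show ?thesis by blast
  qed
  \<comment> \<open>The tolerance carries the factor \<delta> so that it cancels against the one in
    \<open>S\<close>, leaving the radius \<open>(1 / 2) ^ n\<close>.\<close>
  have "\<exists>u. \<forall>n. (g (u n) < \<infinity> \<and> (n = 0 \<longrightarrow> u n = x)) \<and>
          u (Suc n) \<in> S (u n) \<and> (\<forall>v \<in> S (u n). g (u (Suc n)) \<le> g v + ereal (\<delta> * (1 / 2) ^ n))"
  proof (rule dependent_nat_choice)
    fix z and n :: nat assume "g z < \<infinity> \<and> (n = 0 \<longrightarrow> z = x)"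
    then show "\<exists>w. (g w < \<infinity> \<and> (Suc n = 0 \<longrightarrow> w = x)) \<and>
        w \<in> S z \<and> (\<forall>v \<in> S z. g w \<le> g v + ereal (\<delta> * (1 / 2) ^ n))"
      using step[of z "\<delta> * (1 / 2) ^ n"] S_fin \<delta> by auto
  qed (use x in auto)
  then obtain u where u: "\<And>n. g (u n) < \<infinity>" "u 0 = x" "\<And>n. u (Suc n) \<in> S (u n)"
      "\<And>n v. v \<in> S (u n) \<Longrightarrow> g (u (Suc n)) \<le> g v + ereal (\<delta> * (1 / 2) ^ n)"
    by blast
  have nested: "u k \<in> S (u n)" if "n \<le> k" for n k
    using that by (induction k rule: dec_induct) (auto intro: S_self S_trans u(3))
  \<comment> \<open>Such a \<open>v\<close> also lies in \<open>S (u n)\<close>, where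
    \<open>u (Suc n)\<close> is nearly minimal, so \<open>g\<close> can drop only slightly from
    \<open>u (Suc n)\<close> to \<open>v\<close>; membership demands a drop proportional to the
    distance.\<close>
  have small: "dist (u (Suc n)) v \<le> (1 / 2) ^ n" if "v \<in> S (u (Suc n))" for v n
  proof -
    have "g v + ereal (\<delta> * dist (u (Suc n)) v) \<le> g (u (Suc n))"
      using that by (simp add: S_def)
    also have "\<dots> \<le> g v + ereal (\<delta> * (1 / 2) ^ n)"
      using S_trans[OF u(3) that] by (rule u(4))
    finally have "\<delta> * dist (u (Suc n)) v \<le> \<delta> * (1 / 2) ^ n"
      using lb[of v] S_fin[OF that u(1)] by (cases "g v") auto
    then show ?thesis using \<delta> by simp
  qed
  have half: "(\<lambda>n. (1 / 2 :: real) ^ n) \<longlonglongrightarrow> 0"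
    by (rule LIMSEQ_power_zero) simp
  have "Cauchy u"
    unfolding Cauchy_altdef2
  proof (intro allI impI)
    fix e :: real assume "e > 0"
    then obtain n where "(1 / 2) ^ n < e"
      using real_arch_pow_inv[of e "1 / 2"] by auto
    then have "dist (u k) (u (Suc n)) < e" if "k \<ge> Suc n" for k
      using small[OF nested[OF that]] by (simp add: dist_commute)
    then show "\<exists>N. \<forall>n\<ge>N. dist (u n) (u N) < e" by blast
  qed
  then obtain y where y: "u \<longlonglongrightarrow> y"
    using Cauchy_convergent convergent_def by blast
  \<comment> \<open>Closedness of \<open>S (u n)\<close> along the sequence: otherwise a real
    \<open>c\<close> below \<open>g y\<close> is eventually exceeded by \<open>g (u k)\<close>,
    while membership of \<open>u k\<close> pushes \<open>g (u k)\<close> below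
    \<open>c\<close>.\<close>
  have y_S: "y \<in> S (u n)" for n
  proof (rule ccontr)
    assume *: "y \<notin> S (u n)"
    obtain a where a: "g (u n) = ereal a"
      using u(1)[of n] lb[of "u n"] by (cases "g (u n)") auto
    from * have "ereal (a - \<delta> * dist (u n) y) < g y"
      using lb[of y] by (cases "g y") (auto simp: S_def a)
    then obtain c where c: "ereal (a - \<delta> * dist (u n) y) < ereal c" "ereal c < g y"
      using ereal_dense2 by blast
    have "\<forall>\<^sub>F z in nhds y. ereal c < g z"
      using lsc c(2) unfolding lsc_iff_eventually by blast
    then have "\<forall>\<^sub>F k in sequentially. ereal c < g (u k)"
      using y unfolding filterlim_iff by blast
    moreover have "(\<lambda>k. a - \<delta> * dist (u n) (u k)) \<longlonglongrightarrow> a - \<delta> * dist (u n) y"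
      by (intro tendsto_intros y)
    then have "\<forall>\<^sub>F k in sequentially. a - \<delta> * dist (u n) (u k) < c"
      using c(1) by (intro order_tendstoD(2)) auto
    ultimately have "\<forall>\<^sub>F k in sequentially. False"
      using eventually_ge_at_top[of n]
    proof eventually_elim
      case (elim k)
      with nested[OF elim(3)] show ?case
        by (cases "g (u k)") (auto simp: S_def a)
    qed
    then show False by simp
  qed
  show thesis
  proof (rule that)
    show "g y + ereal (\<delta> * dist x y) \<le> g x"
      using y_S[of 0] by (simp add: S_def u(2))
    fix z assume "g z + ereal (\<delta> * dist y z) \<le> g y"
    \<comment> \<open>Lying in every set, \<open>z\<close> is a limit of \<open>u\<close> as
      well.\<close>
    then have "z \<in> S (u n)" for n
      using S_trans[OF y_S] by (simp add: S_def)
    then have "(\<lambda>n. dist (u (Suc n)) z) \<longlonglongrightarrow> 0"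
      by (intro tendsto_sandwich[OF _ _ tendsto_const half] always_eventually) (auto intro: small)
    then have "u \<longlonglongrightarrow> z"
      unfolding tendsto_dist_iff[of u] by (rule LIMSEQ_imp_Suc)
    with y show "z = y" by (rule LIMSEQ_unique[OF _ , THEN sym])
  qed
qed

lemma slope_le:
  assumes "f x \<noteq> \<infinity>" "0 < e" "local_minimizer (\<lambda>y. f y + ereal (e * dist x y)) x"
  shows "slope f x \<le> ereal e"
  using assms unfolding slope_def by (auto intro!: Inf_lower)

text \<open>The lower limit admits the point \<open>x\<close> itself, so every eventual property
  holds there.\<close>

lemma limiting_slope_le_slope: "limiting_slope f x \<le> slope f x"
  unfolding limiting_slope_def Liminf_def
proof (rule SUP_least)
  fix P assume "P \<in> {P. eventually P (inf (nhds x) (filtercomap f (nhds (f x))))}"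
  then obtain Q R where "eventually Q (nhds x)" "eventually R (filtercomap f (nhds (f x)))"
    and QR: "\<And>y. Q y \<Longrightarrow> R y \<Longrightarrow> P y"
    unfolding eventually_inf by auto
  then have "P x"
    unfolding eventually_filtercomap by (blast dest: eventually_nhds_x_imp_x)
  then show "(INF y\<in>{y. P y}. slope f y) \<le> slope f x"
    by (intro INF_lower) simp
qed

text \<open>Near \<open>y\<close> the squared distance to \<open>x\<close> grows at rate about
  \<open>2 * dist x y\<close>, which accounts for the first term. One \<delta> comes from Ekeland's
  principle, the other absorbs the quadratic remainder.\<close>

lemma proximal_descent_point:
  fixes f :: "'a::complete_space \<Rightarrow> ereal"
  assumes lsc: "lsc f" and lb: "\<And>y. ereal m \<le> f y" and x: "f x < \<infinity>"
    and \<alpha>: "\<alpha> > 0" and \<delta>: "\<delta> > 0"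
  obtains y where "f y + ereal (\<alpha> * (dist x y)\<^sup>2) \<le> f x"
    and "slope f y \<le> ereal (2 * \<alpha> * dist x y + 2 * \<delta>)"
proof -
  define g where "g y = f y + ereal (\<alpha> * (dist x y)\<^sup>2)" for y
  have "lsc g"
    unfolding g_def by (intro lsc_add_continuous lsc continuous_intros)
  moreover have "ereal m \<le> g y" for y
    using add_mono[OF lb[of y], of 0 "ereal (\<alpha> * (dist x y)\<^sup>2)"] \<alpha> by (simp add: g_def)
  moreover have "g x < \<infinity>" using x by (simp add: g_def)
  ultimately obtain y where y: "g y + ereal (\<delta> * dist x y) \<le> g x"
    and min: "\<And>z. g z + ereal (\<delta> * dist y z) \<le> g y \<Longrightarrow> z = y"
    using ekeland[of g m x \<delta>] \<delta> by blast
  have desc: "f y + ereal (\<alpha> * (dist x y)\<^sup>2) \<le> f x"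
  proof -
    have "g y + 0 \<le> g y + ereal (\<delta> * dist x y)"
      using \<delta> by (intro add_left_mono) simp
    with y show ?thesis by (simp add: g_def)
  qed
  then obtain b where b: "f y = ereal b"
    using lb[of y] x by (cases "f y") auto
  let ?e = "2 * \<alpha> * dist x y + 2 * \<delta>"
  have e: "?e > 0" using \<alpha> \<delta> by (simp add: add_nonneg_pos)
  have "local_minimizer (\<lambda>z. f z + ereal (?e * dist y z)) y"
    unfolding local_minimizer_def eventually_nhds_metric
  proof (intro exI conjI allI impI)
    \<comment> \<open>Within this radius \<alpha> times the squared distance to \<open>y\<close> is
      at most \<delta> times the distance.\<close>
    show "\<delta> / \<alpha> > 0" using \<alpha> \<delta> by simp
    fix z assume "dist z y < \<delta> / \<alpha>"
    then have z: "\<alpha> * dist y z \<le> \<delta>"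
      using \<alpha> by (simp add: field_simps dist_commute)
    show "f y + ereal (?e * dist y y) \<le> f z + ereal (?e * dist y z)"
    proof (cases "z = y")
      case False
      with min[of z] have "g y < g z + ereal (\<delta> * dist y z)" by force
      moreover have "\<alpha> * (dist x z)\<^sup>2 + \<delta> * dist y z \<le> \<alpha> * (dist x y)\<^sup>2 + ?e * dist y z"
      proof -
        have "(dist x z)\<^sup>2 \<le> (dist x y + dist y z)\<^sup>2"
          by (intro power_mono dist_triangle) simp
        then have "\<alpha> * (dist x z)\<^sup>2 \<le> \<alpha> * (dist x y + dist y z)\<^sup>2"
          using \<alpha> by simp
        moreover have "\<alpha> * dist y z * dist y z \<le> \<delta> * dist y z"
          using z by (intro mult_right_mono) auto
        ultimately show ?thesis by (simp add: algebra_simps power2_eq_square)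
      qed
      ultimately show ?thesis
        using lb[of z] by (cases "f z") (auto simp: g_def b)
    qed simp
  qed
  then have "slope f y \<le> ereal ?e"
    using e b by (intro slope_le) auto
  with desc show thesis by (rule that)
qed

theorem proposition5p3:
  fixes f :: "'a::complete_space \<Rightarrow> ereal" and x :: 'a and \<alpha> \<beta> :: real
  assumes "lsc f"
    and "\<exists>m::real. \<forall>y. ereal m \<le> f y"
    and "f x < \<infinity>"
    and "\<alpha> > 0" and "\<beta> > 0" and "\<alpha> * \<beta> < 1 / 2"
  shows "\<exists>x'. f x - f x' \<ge> ereal (\<alpha> * (dist x x')\<^sup>2)
            \<and> ereal (dist x x') \<ge> ereal \<beta> * limiting_slope f x'"
proof -
  from assms(2) obtain m where lb: "\<And>y. ereal m \<le> f y" by blast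
  obtain a where a: "f x = ereal a"
    using lb[of x] assms(3) by (cases "f x") auto
  let ?E = "\<lambda>\<delta> y. 2 * \<alpha> * dist x y + 2 * \<delta>"
  let ?D = "\<lambda>\<delta> y. f y + ereal (\<alpha> * (dist x y)\<^sup>2) \<le> f x \<and> slope f y \<le> ereal (?E \<delta> y)"
  show ?thesis
  proof (cases "\<exists>\<delta> y. ?D \<delta> y \<and> \<beta> * ?E \<delta> y \<le> dist x y")
    case True
    then obtain \<delta> y where y: "?D \<delta> y" "\<beta> * ?E \<delta> y \<le> dist x y" by blast
    have "ereal (\<alpha> * (dist x y)\<^sup>2) \<le> f x - f y"
      using y(1) lb[of y] by (cases "f y") (auto simp: a)
    moreover have "ereal \<beta> * limiting_slope f y \<le> ereal \<beta> * ereal (?E \<delta> y)"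
      using y(1) limiting_slope_le_slope[of f y] assms(5)
      by (intro ereal_mult_left_mono) (auto intro: order_trans)
    then have "ereal \<beta> * limiting_slope f y \<le> ereal (dist x y)"
      using y(2) by (simp add: order_trans)
    ultimately show ?thesis by blast
  next
    case False
    \<comment> \<open>If \<open>y\<close> fails the test, moving the \<alpha> term to the left gives
      \<open>q * dist x y < 2 * \<beta> * \<delta>\<close>; positivity of \<open>q\<close> then
      forces \<open>y\<close> towards \<open>x\<close>.\<close>
    define q where "q = 1 - 2 * (\<alpha> * \<beta>)"
    have q: "q > 0" using assms(6) by (simp add: q_def)
    have "(INF y\<in>{y. dist y x < r \<and> \<bar>f y - f x\<bar> < ereal r}. slope f y) \<le> 0" if r: "r > 0" for r
    proof (rule ereal_le_epsilon2)
      fix e :: real assume e: "e > 0"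
      have "\<forall>\<^sub>F y in nhds x. ereal (a - r) < f y"
        using assms(1) r a unfolding lsc_iff_eventually by simp
      then obtain s where s: "s > 0" "\<And>y. dist y x < s \<Longrightarrow> ereal (a - r) < f y"
        unfolding eventually_nhds_metric by blast
      \<comment> \<open>The bounds \<open>r\<close> and \<open>s\<close> control position and value
        of \<open>y\<close>; the third gives the distance term of the slope bound half of
        \<open>e\<close>.\<close>
      define t where "t = min (min r s) (e / (4 * \<alpha>))"
      have t: "t > 0" using r s(1) e assms(4) by (simp add: t_def)
      \<comment> \<open>The first bound gives \<open>2 * \<delta>\<close> the other half of
        \<open>e\<close>; the second yields \<open>dist x y < t\<close>.\<close>
      define \<delta> where "\<delta> = min (e / 4) (q * t / (2 * \<beta>))"
      have \<delta>: "\<delta> > 0" using t e q assms(5) by (simp add: \<delta>_def)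
      obtain y where y: "?D \<delta> y"
        using proximal_descent_point[OF assms(1) lb assms(3,4) \<delta>] by blast
      with False have "dist x y < \<beta> * ?E \<delta> y" by (meson not_le)
      then have "q * dist x y < 2 * \<beta> * \<delta>" by (simp add: q_def algebra_simps)
      also have "\<dots> \<le> 2 * \<beta> * (q * t / (2 * \<beta>))"
        using assms(5) by (intro mult_left_mono) (auto simp: \<delta>_def)
      also have "\<dots> = q * t" using assms(5) by simp
      finally have dist: "dist x y < t" using q by simp
      have "ereal (a - r) < f y" "dist y x < r"
        using s(2)[of y] dist by (auto simp: t_def dist_commute)
      \<comment> \<open>Semicontinuity bounds \<open>f y\<close> only from below; the descent
        inequality supplies the upper bound.\<close>
      moreover have "f y \<le> ereal a"
      proof -
        have "0 \<le> \<alpha> * (dist x y)\<^sup>2" using assms(4) by simp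
        with conjunct1[OF y] show ?thesis by (cases "f y") (auto simp: a)
      qed
      ultimately have mem: "y \<in> {y. dist y x < r \<and> \<bar>f y - f x\<bar> < ereal r}"
        using r by (cases "f y") (auto simp: a)
      have "dist x y \<le> e / (4 * \<alpha>)" using dist by (simp add: t_def)
      then have "2 * \<alpha> * dist x y \<le> e / 2"
        using assms(4) by (simp add: field_simps)
      moreover have "2 * \<delta> \<le> e / 2" by (simp add: \<delta>_def)
      ultimately have "?E \<delta> y \<le> e" by simp
      then have "slope f y \<le> ereal e"
        using order_trans[OF conjunct2[OF y]] by simp
      then show "(INF y\<in>{y. dist y x < r \<and> \<bar>f y - f x\<bar> < ereal r}. slope f y) \<le> 0 + ereal e"
        using INF_lower[OF mem, of "slope f"] by simp
    qed
    then have "limiting_slope f x \<le> 0"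
      by (subst limiting_slope_eq) (auto simp: a intro!: SUP_least)
    then have "ereal \<beta> * limiting_slope f x \<le> ereal (dist x x)"
      using ereal_mult_left_mono[of "limiting_slope f x" 0 "ereal \<beta>"] assms(5) by (simp flip: zero_ereal_def)
    moreover have "ereal (\<alpha> * (dist x x)\<^sup>2) \<le> f x - f x" by (simp add: a)
    ultimately show ?thesis by blast
  qed
qed

end
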